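(* Let $(X,d)$ and $(Y,\varrho)$ be metric spaces. Consider $c> 0$ and $\alpha \in (0,1/c)$, non-empty sets $U\subset X$ and $V\subset Y$, a function $\gamma: X\rightarrow [0,\infty]$ being defined and not identically zero on $U$, and a set-valued mapping $G: X \rightrightarrows Y$. Assume that for each $y \in V$ there is a $\lambda = \lambda(y) \in (0, 1)$ such that for each $(u,v) \in X\times Y$ with $v\in G(u)$ satisfying $$0 < \varrho(v,y) \leq \varrho(z,y) - c\,\max\{d(u,x), \alpha \varrho(v,z)\} \quad \mbox{and} \quad \varrho(z,y) < c\,\gamma(x)$$ for some $x \in U$ and $z \in G(x)$, there is a pair $(u',v') \in X\times Y$ with $v'\in G(u')$ such that $$\varrho(v',y) + c\,\max\{d(u,u'), \alpha \varrho(v,v')\} \leq \lambda\, \varrho(v,y).$$ Then $G$ has property $(\mathcal{O})$ on $U \times V$ for $c$ and $\gamma$.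
   Context: $B_X(x,r)$, $B_Y(y,r)$ denote open balls, $\overline{C}$ the closure of $C$, and $G(M):=\bigcup_{x\in M}G(x)$ for $M\subset X$; the values of $G$ may be empty. The function $\gamma$ need only be defined on $U$. The mapping $G$ has property $(\mathcal{O})$ on $U\times V$ for $c$ and $\gamma$ provided that $B_Y(y,ct)\cap V\subset\overline{G(B_X(x,t))}$ for each $x\in U$, each $y\in G(x)$, and each $t\in(0,\gamma(x))$. *)

theory Defs
  imports "HOL-Analysis.Analysis"
begin

definition set_image :: "('a \<Rightarrow> 'b set) \<Rightarrow> 'a set \<Rightarrow> 'b set" where
  "set_image G M = (\<Union>x\<in>M. G x)"

text \<open>Only the values of \<open>\<gamma>\<close> on \<open>U\<close> matter. The radius \<open>t\<close> is a real number,
  so it is finite also when \<open>\<gamma> x = \<infinity>\<close>.\<close>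

definition property_O ::
  "('a::metric_space \<Rightarrow> 'b::metric_space set) \<Rightarrow> 'a set \<Rightarrow> 'b set \<Rightarrow> real \<Rightarrow> ('a \<Rightarrow> ennreal) \<Rightarrow> bool" where
  "property_O G U V c \<gamma> \<longleftrightarrow>
    (\<forall>x\<in>U. \<forall>y\<in>G x. \<forall>t::real. 0 < t \<and> ennreal t < \<gamma> x \<longrightarrow>
      ball y (c * t) \<inter> V \<subseteq> closure (set_image G (ball x t)))"

end

theory Submission
  imports Defs
begin

text \<open>Starting from \<open>(x, z)\<close>, iterate the descent step. By the triangle inequality the
  displacement bounds telescope, so the inequality
  \<open>dist v y \<le> dist z y - c * max (dist u x) (\<alpha> * dist v z)\<close> is preserved and \<open>u\<close> never
  leaves the ball of radius \<open>dist z y / c < t\<close>, while \<open>dist v y\<close> decays geometrically.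
  Every neighbourhood of \<open>y\<close> is thus reached after finitely many steps, and no completeness
  is needed.\<close>

text \<open>For \<alpha> \<ge> 0 the maximum is a pseudometric on the product of the two spaces; its
  triangle inequality follows from those of the two factors.\<close>

lemma max_dist_triangle:
  fixes u u' x :: "'a::metric_space" and v v' z :: "'b::metric_space"
  assumes "0 \<le> \<alpha>"
  shows "max (dist u' x) (\<alpha> * dist v' z)
    \<le> max (dist u x) (\<alpha> * dist v z) + max (dist u u') (\<alpha> * dist v v')"
proof -
  have "\<alpha> * dist v' z \<le> \<alpha> * (dist v v' + dist v z)"
    by (intro mult_left_mono dist_triangle3 assms)
  then have "\<alpha> * dist v' z \<le> \<alpha> * dist v v' + \<alpha> * dist v z"
    by (simp add: distrib_left)
  moreover have "dist u' x \<le> dist u u' + dist u x"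
    by (rule dist_triangle3)
  ultimately show ?thesis by linarith
qed

text \<open>Two bounds go through one induction: the first makes \<open>step\<close> applicable
  again, the second gives the rate. Since only existence for each \<open>n\<close> is claimed, no
  sequence of pairs has to be chosen.\<close>

lemma descent_iterates:
  fixes x :: "'a::metric_space" and y z :: "'b::metric_space"
  assumes c: "0 \<le> c" and \<alpha>: "0 \<le> \<alpha>" and lam: "0 \<le> lam" "lam \<le> 1" and z: "z \<in> G x"
    and step: "\<And>u v. \<lbrakk>v \<in> G u; 0 < dist v y;
        dist v y \<le> dist z y - c * max (dist u x) (\<alpha> * dist v z)\<rbrakk>
      \<Longrightarrow> \<exists>u' v'. v' \<in> G u' \<and> dist v' y + c * max (dist u u') (\<alpha> * dist v v') \<le> lam * dist v y"
  shows "\<exists>u v. v \<in> G u \<and> dist v y \<le> dist z y - c * max (dist u x) (\<alpha> * dist v z)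
    \<and> dist v y \<le> lam ^ n * dist z y"
proof (induction n)
  case 0
  show ?case using z by (intro exI[of _ x] exI[of _ z]) simp
next
  case (Suc n)
  then obtain u v where v: "v \<in> G u"
    and inv: "dist v y \<le> dist z y - c * max (dist u x) (\<alpha> * dist v z)"
    and le: "dist v y \<le> lam ^ n * dist z y" by blast
  show ?case
  proof (cases "dist v y = 0")
    \<comment> \<open>Here \<open>step\<close> does not apply, but the pair has already reached
      \<open>y\<close> and can be kept: the new bound is nonnegative.\<close>
    case True
    then have "dist v y \<le> lam ^ Suc n * dist z y" using lam by simp
    with v inv show ?thesis by blast
  next
    case False
    then obtain u' v' where v': "v' \<in> G u'"
      and desc: "dist v' y + c * max (dist u u') (\<alpha> * dist v v') \<le> lam * dist v y"
      using step[OF v _ inv] by auto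
    have "c * max (dist u' x) (\<alpha> * dist v' z)
        \<le> c * max (dist u x) (\<alpha> * dist v z) + c * max (dist u u') (\<alpha> * dist v v')"
      using mult_left_mono[OF max_dist_triangle[OF \<alpha>] c] by (simp only: distrib_left)
    \<comment> \<open>With this, \<open>desc\<close> says that the move from \<open>(u, v)\<close>
      to \<open>(u', v')\<close> costs at most the decrease of the distance to \<open>y\<close>,
      which is what the invariant can afford.\<close>
    moreover have "lam * dist v y \<le> dist v y"
      using lam by (simp add: mult_left_le_one_le)
    ultimately have inv': "dist v' y \<le> dist z y - c * max (dist u' x) (\<alpha> * dist v' z)"
      using desc inv by linarith
    have "0 \<le> c * max (dist u u') (\<alpha> * dist v v')"
      using c by (simp add: le_max_iff_disj)
    then have "dist v' y \<le> lam * dist v y" using desc by linarith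
    also have "\<dots> \<le> lam * (lam ^ n * dist z y)"
      using le lam(1) by (rule mult_left_mono)
    finally have "dist v' y \<le> lam ^ Suc n * dist z y" by (simp add: mult.assoc)
    with v' inv' show ?thesis by blast
  qed
qed

theorem proposition4p5:
  fixes c \<alpha> :: real
    and U :: "'a::metric_space set"
    and V :: "'b::metric_space set"
    and \<gamma> :: "'a \<Rightarrow> ennreal"
    and G :: "'a \<Rightarrow> 'b set"
  assumes "c > 0"
    and "0 < \<alpha>" "\<alpha> < 1 / c"
    and "U \<noteq> {}" "V \<noteq> {}"
    and "\<exists>x\<in>U. \<gamma> x \<noteq> 0"
    and "\<forall>y\<in>V. \<exists>lam::real. 0 < lam \<and> lam < 1 \<and>
      (\<forall>u v. v \<in> G u \<longrightarrow>
        (\<exists>x\<in>U. \<exists>z\<in>G x.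
          0 < dist v y \<and>
          dist v y \<le> dist z y - c * max (dist u x) (\<alpha> * dist v z) \<and>
          ennreal (dist z y) < ennreal c * \<gamma> x) \<longrightarrow>
        (\<exists>u' v'. v' \<in> G u' \<and>
          dist v' y + c * max (dist u u') (\<alpha> * dist v v') \<le> lam * dist v y))"
  shows "property_O G U V c \<gamma>"
  unfolding property_O_def
proof (intro ballI allI impI subsetI)
  fix x z y and t :: real
  assume x: "x \<in> U" and z: "z \<in> G x" and t: "0 < t \<and> ennreal t < \<gamma> x"
    and "y \<in> ball z (c * t) \<inter> V"
  then have y: "y \<in> V" and zy: "dist z y < c * t" by auto
  have c: "0 < c" by fact
  \<comment> \<open>Strictness is taken from \<open>zy\<close>, so that \<open>t\<close> and
    \<open>\<gamma> x\<close> need only be compared weakly after multiplication by \<open>c\<close>;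
    this covers an infinite \<open>\<gamma> x\<close> too.\<close>
  have "ennreal (dist z y) < ennreal (c * t)"
    using zy by (simp add: ennreal_less_iff)
  also have "\<dots> = ennreal c * ennreal t"
    using c t by (simp add: ennreal_mult)
  also have "\<dots> \<le> ennreal c * \<gamma> x"
    using t by (intro mult_left_mono) auto
  finally have gam: "ennreal (dist z y) < ennreal c * \<gamma> x" .
  from bspec[OF assms(7) y] obtain lam :: real where lam: "0 < lam" "lam < 1"
    and hyp: "\<forall>u v. v \<in> G u \<longrightarrow>
      (\<exists>x\<in>U. \<exists>z\<in>G x. 0 < dist v y \<and>
        dist v y \<le> dist z y - c * max (dist u x) (\<alpha> * dist v z) \<and>
        ennreal (dist z y) < ennreal c * \<gamma> x) \<longrightarrow>
      (\<exists>u' v'. v' \<in> G u' \<and> dist v' y + c * max (dist u u') (\<alpha> * dist v v') \<le> lam * dist v y)"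
    by (elim exE conjE)
  \<comment> \<open>The witnesses in \<open>hyp\<close> are always the starting pair
    \<open>(x, z)\<close>, so \<open>gam\<close> serves every step of the iteration, and
    \<open>lam\<close>, fixed by \<open>y\<close> alone, never changes.\<close>
  have step: "\<exists>u' v'. v' \<in> G u' \<and> dist v' y + c * max (dist u u') (\<alpha> * dist v v') \<le> lam * dist v y"
    if "v \<in> G u" "0 < dist v y" "dist v y \<le> dist z y - c * max (dist u x) (\<alpha> * dist v z)" for u v
    by (rule hyp[THEN spec, THEN spec, THEN mp, THEN mp], fact)
      (intro bexI[OF _ x] bexI[OF _ z] conjI that gam)
  show "y \<in> closure (set_image G (ball x t))"
    unfolding closure_approachable
  proof (intro allI impI)
    fix e :: real
    assume e: "0 < e"
    have "(\<lambda>n. lam ^ n * dist z y) \<longlonglongrightarrow> 0"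
      using lam by (intro tendsto_mult_left_zero LIMSEQ_power_zero) simp
    then obtain n where n: "lam ^ n * dist z y < e"
      using eventually_happens'[OF sequentially_bot order_tendstoD(2)[OF _ e]] by blast
    have "\<exists>u v. v \<in> G u \<and> dist v y \<le> dist z y - c * max (dist u x) (\<alpha> * dist v z)
        \<and> dist v y \<le> lam ^ n * dist z y"
      by (rule descent_iterates) (rule step z | assumption | use c \<open>0 < \<alpha>\<close> lam in simp)+
    then obtain u v where v: "v \<in> G u"
      and inv: "dist v y \<le> dist z y - c * max (dist u x) (\<alpha> * dist v z)"
      and le: "dist v y \<le> lam ^ n * dist z y"
      by blast
    \<comment> \<open>Since \<open>dist v y\<close> is nonnegative, the invariant bounds the total
      displacement by \<open>dist z y\<close>, uniformly in \<open>n\<close>; the strict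
      \<open>zy\<close> then puts \<open>u\<close> in the open ball.\<close>
    have "c * dist u x \<le> c * max (dist u x) (\<alpha> * dist v z)"
      using c by (intro mult_left_mono) auto
    also have "\<dots> \<le> dist z y" using inv zero_le_dist[of v y] by linarith
    also have "\<dots> < c * t" by (rule zy)
    finally have "u \<in> ball x t" using c by (simp add: dist_commute)
    with v have "v \<in> set_image G (ball x t)" by (auto simp: set_image_def)
    moreover have "dist v y < e" using le n by linarith
    ultimately show "\<exists>w\<in>set_image G (ball x t). dist w y < e" by blast
  qed
qed

end
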